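(* If $i=0,1,\ldots$, then $(\sigma_{i+\frac12})^2=1$ and $(\sigma_{i+1})^2=1$.
   Context: Partition algebras. For an integer $k\ge1$ let $A_k$ be the set of all set partitions of $\{1,\ldots,k,1',\ldots,k'\}$, and let $A_{k-\frac12}\subseteq A_k$ be the subset of those in which $k$ and $k'$ lie in the same block. A partition is drawn as a graph with top vertices $1,\ldots,k$ and bottom vertices $1',\ldots,k'$, whose connected components are the blocks. For $\rho_1,\rho_2\in A_k$, $\rho_1\circ\rho_2\in A_k$ is obtained by placing $\rho_1$ above $\rho_2$, identifying the bottom row of $\rho_1$ with the top row of $\rho_2$, and deleting components contained entirely in the middle row. Let $R=\mathbb{Z}[z]$, $z$ an indeterminate. $\mathcal{A}_k(z)$ is the free $R$-module on $A_k$ with product $\rho_1\rho_2=z^{\ell}\,\rho_1\circ\rho_2$, where $\ell$ is the number of components deleted from the middle row; $\mathcal{A}_{k-\frac12}(z)$ is the subalgebra generated by $A_{k-\frac12}$, and $\mathcal{A}_0(z)=R$. Adding the block $\{k+1,(k+1)'\}$ embeds $\mathcal{A}_k(z)$ in $\mathcal{A}_{k+\frac12}(z)\subseteq\mathcal{A}_{k+1}(z)$; all identities are understood in $\mathcal{A}_k(z)$ for $k$ large enough to contain the elements involved. Elements: $s_i$ ($i\ge1$) has blocks $\{i,(i+1)'\},\{i+1,i'\}$ and $\{m,m'\}$ for $m\ne i,i+1$; $p_j$ ($j\ge1$) has blocks $\{j\},\{j'\}$ and $\{m,m'\}$ for $m\ne j$; $p_{i+\frac12}$ ($i\ge1$)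 has blocks $\{i,i+1,i',(i+1)'\}$ and $\{m,m'\}$ for $m\neq i,i+1$. Recursive definitions. $L_0=0$, $L_1=p_1$, $\sigma_1=1$, $\sigma_2=s_1$, and $L_{i+1}=-s_iL_ip_{i+\frac12}-p_{i+\frac12}L_is_i+p_{i+\frac12}L_ip_{i+1}p_{i+\frac12}+s_iL_is_i+\sigma_{i+1}$ for $i\ge1$, where for $i\ge2$ $\sigma_{i+1}=s_{i-1}s_i\sigma_is_is_{i-1}+s_ip_{i-\frac12}L_{i-1}s_ip_{i-\frac12}s_i+p_{i-\frac12}L_{i-1}s_ip_{i-\frac12}-s_ip_{i-\frac12}L_{i-1}s_{i-1}p_{i+\frac12}p_ip_{i-\frac12}-p_{i-\frac12}p_ip_{i+\frac12}s_{i-1}L_{i-1}p_{i-\frac12}s_i.$ Also $\sigma_{\frac12}=1$, $\sigma_{1+\frac12}=1$, and for $i\ge2$ $\sigma_{i+\frac12}=s_{i-1}s_i\sigma_{i-\frac12}s_is_{i-1}+p_{i-\frac12}L_{i-1}s_ip_{i-\frac12}s_i+s_ip_{i-\frac12}L_{i-1}s_ip_{i-\frac12}-p_{i-\frac12}L_{i-1}s_{i-1}p_{i+\frac12}p_ip_{i-\frac12}-s_ip_{i-\frac12}p_ip_{i+\frac12}s_{i-1}L_{i-1}p_{i-\frac12}s_i.$ *)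

theory Defs
  imports
    "HOL-Computational_Algebra.Polynomial"
    "HOL-Library.Poly_Mapping"
    "HOL-Library.Disjoint_Sets"
begin

section \<open>Partition diagrams and their composition\<close>

text \<open>
  \<open>Top i\<close> is the vertex \<open>i\<close>, \<open>Bot i\<close> is the vertex \<open>i'\<close>. The vertices \<open>Mid i\<close> never occur in a
  diagram; they only label the middle row of two stacked diagrams.
\<close>

datatype vertex = Top nat | Mid nat | Bot nat

type_synonym diagram = "vertex set set"

definition diagrams :: "nat \<Rightarrow> diagram set" where
  "diagrams k = {d. partition_on (Top ` {1..k} \<union> Bot ` {1..k}) d}"

fun upper :: "vertex \<Rightarrow> vertex" where
  "upper (Top i) = Top i"
| "upper (Mid i) = Mid i"
| "upper (Bot i) = Mid i"

fun lower :: "vertex \<Rightarrow> vertex" where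
  "lower (Top i) = Mid i"
| "lower (Mid i) = Mid i"
| "lower (Bot i) = Bot i"

definition stack :: "diagram \<Rightarrow> diagram \<Rightarrow> vertex set set" where
  "stack d e = (`) upper ` d \<union> (`) lower ` e"

text \<open>Connected components of the three-row graph in which \<open>d\<close> is placed above \<open>e\<close>.\<close>

definition components :: "diagram \<Rightarrow> diagram \<Rightarrow> vertex set set" where
  "components d e = \<Union>(stack d e) // {(x, y). \<exists>B\<in>stack d e. x \<in> B \<and> y \<in> B}\<^sup>+"

definition compose :: "diagram \<Rightarrow> diagram \<Rightarrow> diagram" where
  "compose d e = (\<lambda>C. C - range Mid) ` components d e - {{}}"

definition deleted :: "diagram \<Rightarrow> diagram \<Rightarrow> nat" where
  "deleted d e = card {C \<in> components d e. C \<subseteq> range Mid}"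


section \<open>The partition algebra over \<open>\<int>[z]\<close>\<close>

type_synonym elt = "diagram \<Rightarrow>\<^sub>0 int poly"

text \<open>
  The free \<open>\<int>[z]\<close>-module on \<open>diagrams k\<close>. Its additive structure is that of type \<open>elt\<close>;
  the product below is the same expression for every \<open>k\<close>, since \<open>compose\<close> and \<open>deleted\<close> do not
  mention \<open>k\<close>. It is not the convolution product of \<^theory>\<open>HOL-Library.Poly_Mapping\<close>.
\<close>

definition partition_algebra :: "nat \<Rightarrow> elt set" where
  "partition_algebra k = {a. Poly_Mapping.keys a \<subseteq> diagrams k}"

definition pmult :: "elt \<Rightarrow> elt \<Rightarrow> elt"  (infixl "\<odot>" 70) where
  "a \<odot> b = (\<Sum>d\<in>Poly_Mapping.keys a. \<Sum>e\<in>Poly_Mapping.keys b.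
     Poly_Mapping.single (compose d e)
       (monom 1 (deleted d e) * Poly_Mapping.lookup a d * Poly_Mapping.lookup b e))"

definition strands :: "nat set \<Rightarrow> diagram" where
  "strands M = (\<lambda>m. {Top m, Bot m}) ` M"

definition basis :: "diagram \<Rightarrow> elt" where
  "basis d = Poly_Mapping.single d 1"

definition one :: "nat \<Rightarrow> elt" where
  "one k = basis (strands {1..k})"

definition s :: "nat \<Rightarrow> nat \<Rightarrow> elt" where
  "s k i = basis ({{Top i, Bot (i + 1)}, {Top (i + 1), Bot i}} \<union> strands ({1..k} - {i, i + 1}))"

definition p :: "nat \<Rightarrow> nat \<Rightarrow> elt" where
  "p k j = basis ({{Top j}, {Bot j}} \<union> strands ({1..k} - {j}))"

text \<open>\<open>p_half k i\<close> is $p_{i+\frac12}$, so $p_{i-\frac12}$ is \<open>p_half k (i - 1)\<close>.\<close>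

definition p_half :: "nat \<Rightarrow> nat \<Rightarrow> elt" where
  "p_half k i = basis ({{Top i, Top (i + 1), Bot i, Bot (i + 1)}} \<union> strands ({1..k} - {i, i + 1}))"


section \<open>The elements \<open>L\<close> and \<open>\<sigma>\<close>\<close>

text \<open>
  The right-hand sides of the recursions. In \<open>L_rec\<close>, \<open>L\<close> and \<open>\<sigma>\<close> stand for $L_i$ and
  $\sigma_{i+1}$; in \<open>sigma_rec\<close>, \<open>\<sigma>\<close> and \<open>L\<close> stand for $\sigma_i$ and $L_{i-1}$; in
  \<open>sigma_half_rec\<close>, they stand for $\sigma_{i-\frac12}$ and $L_{i-1}$.
\<close>

definition L_rec :: "nat \<Rightarrow> nat \<Rightarrow> elt \<Rightarrow> elt \<Rightarrow> elt" where
  "L_rec k i L \<sigma> =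
     - (s k i \<odot> L \<odot> p_half k i)
     - p_half k i \<odot> L \<odot> s k i
     + p_half k i \<odot> L \<odot> p k (i + 1) \<odot> p_half k i
     + s k i \<odot> L \<odot> s k i
     + \<sigma>"

definition sigma_rec :: "nat \<Rightarrow> nat \<Rightarrow> elt \<Rightarrow> elt \<Rightarrow> elt" where
  "sigma_rec k i \<sigma> L =
     s k (i - 1) \<odot> s k i \<odot> \<sigma> \<odot> s k i \<odot> s k (i - 1)
     + s k i \<odot> p_half k (i - 1) \<odot> L \<odot> s k i \<odot> p_half k (i - 1) \<odot> s k i
     + p_half k (i - 1) \<odot> L \<odot> s k i \<odot> p_half k (i - 1)
     - s k i \<odot> p_half k (i - 1) \<odot> L \<odot> s k (i - 1) \<odot> p_half k i \<odot> p k i \<odot> p_half k (i - 1)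
     - p_half k (i - 1) \<odot> p k i \<odot> p_half k i \<odot> s k (i - 1) \<odot> L \<odot> p_half k (i - 1) \<odot> s k i"

definition sigma_half_rec :: "nat \<Rightarrow> nat \<Rightarrow> elt \<Rightarrow> elt \<Rightarrow> elt" where
  "sigma_half_rec k i \<sigma> L =
     s k (i - 1) \<odot> s k i \<odot> \<sigma> \<odot> s k i \<odot> s k (i - 1)
     + p_half k (i - 1) \<odot> L \<odot> s k i \<odot> p_half k (i - 1) \<odot> s k i
     + s k i \<odot> p_half k (i - 1) \<odot> L \<odot> s k i \<odot> p_half k (i - 1)
     - p_half k (i - 1) \<odot> L \<odot> s k (i - 1) \<odot> p_half k i \<odot> p k i \<odot> p_half k (i - 1)
     - s k i \<odot> p_half k (i - 1) \<odot> p k i \<odot> p_half k i \<odot> s k (i - 1) \<odot> L \<odot> p_half k (i - 1) \<odot> s k i"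

text \<open>
  \<open>L k i\<close> and \<open>sigma k i\<close> are $L_i$ and $\sigma_i$ as elements of the \<open>k\<close>-th algebra, meaningful
  for \<open>i \<le> k\<close>. There is no $\sigma_0$; the value \<open>sigma k 0\<close> is never used.
\<close>

function L :: "nat \<Rightarrow> nat \<Rightarrow> elt" and sigma :: "nat \<Rightarrow> nat \<Rightarrow> elt" where
  "L k 0 = 0"
| "L k (Suc 0) = p k 1"
| "L k (Suc (Suc j)) = L_rec k (Suc j) (L k (Suc j)) (sigma k (Suc (Suc j)))"
| "sigma k 0 = undefined"
| "sigma k (Suc 0) = one k"
| "sigma k (Suc (Suc 0)) = s k 1"
| "sigma k (Suc (Suc (Suc j))) = sigma_rec k (Suc (Suc j)) (sigma k (Suc (Suc j))) (L k (Suc j))"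
  by pat_completeness auto
termination
  by (relation "measure (case_sum (\<lambda>(k, i). 2 * i + 1) (\<lambda>(k, i). 2 * i))") auto

text \<open>\<open>sigma_half k i\<close> is $\sigma_{i+\frac12}$, meaningful for \<open>i + 1 \<le> k\<close>.\<close>

fun sigma_half :: "nat \<Rightarrow> nat \<Rightarrow> elt" where
  "sigma_half k 0 = one k"
| "sigma_half k (Suc 0) = one k"
| "sigma_half k (Suc (Suc j)) = sigma_half_rec k (Suc (Suc j)) (sigma_half k (Suc j)) (L k (Suc j))"


section \<open>Membership in the partition algebra\<close>

lemma equiv_stack: "equiv (\<Union>X) ({(x, y). \<exists>B\<in>X. x \<in> B \<and> y \<in> B}\<^sup>+)"
proof (rule equivI)
  let ?r = "{(x, y). \<exists>B\<in>X. x \<in> B \<and> y \<in> B}"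
  have "?r \<subseteq> \<Union>X \<times> \<Union>X" by auto
  then show "?r\<^sup>+ \<subseteq> \<Union>X \<times> \<Union>X" by (rule trancl_subset_Sigma)
  show "refl_on (\<Union>X) (?r\<^sup>+)" by (auto simp: refl_on_def intro!: r_into_trancl)
  show "sym (?r\<^sup>+)" by (rule sym_trancl) (auto simp: sym_def)
  show "trans (?r\<^sup>+)" by simp
qed

lemma compose_in_diagrams:
  assumes "d \<in> diagrams k" "e \<in> diagrams k"
  shows "compose d e \<in> diagrams k"
proof -
  have U: "\<Union>d = Top ` {1..k} \<union> Bot ` {1..k}" "\<Union>e = Top ` {1..k} \<union> Bot ` {1..k}"
    using assms by (auto simp: diagrams_def partition_on_def)
  have "\<Union>(stack d e) = upper ` \<Union>d \<union> lower ` \<Union>e"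
    unfolding stack_def by auto
  also have "\<dots> = Top ` {1..k} \<union> Mid ` {1..k} \<union> Bot ` {1..k}"
    unfolding U by (simp add: image_Un image_image) blast
  finally have V: "\<Union>(stack d e) = Top ` {1..k} \<union> Mid ` {1..k} \<union> Bot ` {1..k}" .
  have "partition_on (\<Union>(stack d e)) (components d e)"
    unfolding components_def by (rule partition_on_quotient[OF equiv_stack])
  then have "partition_on (- range Mid \<inter> \<Union>(stack d e)) ((\<inter>) (- range Mid) ` components d e - {{}})"
    by (rule partition_on_restrict)
  moreover have "- range Mid \<inter> \<Union>(stack d e) = Top ` {1..k} \<union> Bot ` {1..k}"
    unfolding V by auto
  moreover have "(\<inter>) (- range Mid) ` components d e = (\<lambda>C. C - range Mid) ` components d e"
    by (rule image_cong) auto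
  ultimately show ?thesis by (simp add: diagrams_def compose_def)
qed

lemma partition_algebra_0: "0 \<in> partition_algebra k"
  by (simp add: partition_algebra_def)

lemma partition_algebra_add:
  "a \<in> partition_algebra k \<Longrightarrow> b \<in> partition_algebra k \<Longrightarrow> a + b \<in> partition_algebra k"
  unfolding partition_algebra_def using keys_add[of a b] by blast

lemma partition_algebra_uminus:
  "a \<in> partition_algebra k \<Longrightarrow> - a \<in> partition_algebra k"
  by (simp add: partition_algebra_def Poly_Mapping.keys_def lookup_uminus)

lemma partition_algebra_diff:
  "a \<in> partition_algebra k \<Longrightarrow> b \<in> partition_algebra k \<Longrightarrow> a - b \<in> partition_algebra k"
  using partition_algebra_add[of a k "- b"] partition_algebra_uminus by simp

lemma partition_algebra_sum:
  "(\<And>x. x \<in> X \<Longrightarrow> f x \<in> partition_algebra k) \<Longrightarrow> sum f X \<in> partition_algebra k"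
  by (induction X rule: infinite_finite_induct)
    (auto simp: partition_algebra_0 intro: partition_algebra_add)

lemma partition_algebra_mult:
  "a \<in> partition_algebra k \<Longrightarrow> b \<in> partition_algebra k \<Longrightarrow> a \<odot> b \<in> partition_algebra k"
  unfolding pmult_def
  by (intro partition_algebra_sum) (auto simp: partition_algebra_def compose_in_diagrams subsetD)

lemma partition_algebra_basis: "d \<in> diagrams k \<Longrightarrow> basis d \<in> partition_algebra k"
  by (simp add: partition_algebra_def basis_def)

lemma one_in: "one k \<in> partition_algebra k"
  unfolding one_def
  by (rule partition_algebra_basis)
    (auto simp: diagrams_def strands_def partition_on_def disjoint_def)

lemma s_in: "1 \<le> i \<Longrightarrow> i < k \<Longrightarrow> s k i \<in> partition_algebra k"
  unfolding s_def
  by (rule partition_algebra_basis)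
    (auto simp: diagrams_def strands_def partition_on_def disjoint_def)

lemma p_in: "1 \<le> j \<Longrightarrow> j \<le> k \<Longrightarrow> p k j \<in> partition_algebra k"
  unfolding p_def
  by (rule partition_algebra_basis)
    (auto simp: diagrams_def strands_def partition_on_def disjoint_def)

lemma p_half_in: "1 \<le> i \<Longrightarrow> i < k \<Longrightarrow> p_half k i \<in> partition_algebra k"
  unfolding p_half_def
  by (rule partition_algebra_basis)
    (auto simp: diagrams_def strands_def partition_on_def disjoint_def)

lemmas partition_algebra_intros =
  partition_algebra_add partition_algebra_uminus partition_algebra_diff partition_algebra_mult
  one_in s_in p_in p_half_in

lemma L_sigma_in:
  "i \<le> k \<Longrightarrow> L k i \<in> partition_algebra k"
  "1 \<le> i \<Longrightarrow> i \<le> k \<Longrightarrow> sigma k i \<in> partition_algebra k"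
proof (induction k i and k i rule: L_sigma.induct)
  case (3 k j)
  then show ?case by (auto simp: L_rec_def intro!: partition_algebra_intros)
next
  case (7 k j)
  then show ?case by (auto simp: sigma_rec_def intro!: partition_algebra_intros)
qed (auto simp: partition_algebra_0 intro!: partition_algebra_intros)

lemma sigma_half_in: "i + 1 \<le> k \<Longrightarrow> sigma_half k i \<in> partition_algebra k"
proof (induction k i rule: sigma_half.induct)
  case (3 k j)
  then show ?case
    by (auto simp: sigma_half_rec_def L_sigma_in intro!: partition_algebra_intros)
qed (auto intro!: partition_algebra_intros)

end

theory Submission
  imports Defs "HOL-Library.FuncSet" "HOL-Combinatorics.Transposition"
begin

text \<open>
  For every natural number \<open>n\<close> the \<open>k\<close>-th partition algebra with \<open>z\<close> specialised to \<open>n\<close> acts on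
  the functions of words of length \<open>k\<close> over an alphabet of \<open>n\<close> letters (Schur--Weyl duality):
  the matrix entry of a diagram at a pair of words \<open>(w, v)\<close> is \<open>1\<close> if writing \<open>w\<close> on the top row
  and \<open>v\<close> on the bottom row labels every block with a single letter, and \<open>0\<close> otherwise.
  A component that the product deletes can be labelled with any of the \<open>n\<close> letters, which
  accounts for the factor \<open>z\<close> (\<open>entry_mult\<close>).
  Elements of the algebra that act alike for all \<open>n\<close> are equal (\<open>act_faithful\<close>):
  with enough letters each diagram has a pair of words whose level sets are exactly its blocks,
  and a polynomial that vanishes at all large \<open>n\<close> is zero.

  On words the recursive elements have a simple meaning. Let $(a\,b)$ be the transposition of
  two letters of the alphabet, applied to the letters at certain positions of a word
  $w = w_1 w_2 \ldots w_k$, and let $f$ be a function of words. For \<open>i \<ge> 1\<close>: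
  \<^item> $L_i f(w)$ is the sum over all letters $d$ of the values of $f$ at the words in which
    $(w_i\,d)$ has been applied to the positions $1, \ldots, i$;
  \<^item> $\sigma_{i+1}$ replaces $w$ by the word in which $(w_i\,w_{i+1})$ has been applied to the
    positions $1, \ldots, i + 1$;
  \<^item> $\sigma_{i+\frac12}$ does the same for the positions $1, \ldots, i - 1$ only.

  This is shown by evaluating the recursions on words
  (\<open>L_rec_action\<close>, \<open>sigma_rec_action\<close>, \<open>sigma_half_rec_action\<close>): only the letters at the last two
  or three positions decide which summands survive. A transposition that is applied twice is the
  identity, and the second application uses the same transposition, because the first one
  exchanges the letters $w_i$ and $w_{i+1}$ or leaves both in place. Hence both elements are
  involutions in every specialisation, so their squares are \<open>1\<close> over \<open>\<int>[z]\<close>.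
\<close>


section \<open>Labellings that are constant on blocks\<close>

definition fits :: "('v \<Rightarrow> 'l) \<Rightarrow> 'v set set \<Rightarrow> bool" where
  "fits g X \<longleftrightarrow> (\<forall>B\<in>X. \<forall>x\<in>B. \<forall>y\<in>B. g x = g y)"

lemma fitsD: "fits g X \<Longrightarrow> B \<in> X \<Longrightarrow> x \<in> B \<Longrightarrow> y \<in> B \<Longrightarrow> g x = g y"
  unfolding fits_def by blast

lemma fits_Un: "fits g (X \<union> Y) \<longleftrightarrow> fits g X \<and> fits g Y"
  unfolding fits_def by blast

lemma fits_image: "fits g ((`) h ` X) \<longleftrightarrow> fits (g \<circ> h) X"
  unfolding fits_def by simp

lemma fits_cong: "(\<And>x. x \<in> \<Union>X \<Longrightarrow> g x = h x) \<Longrightarrow> fits g X \<longleftrightarrow> fits h X"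
  unfolding fits_def by (metis UnionI)

lemma fits_restrict: "fits g X \<Longrightarrow> fits g ((\<lambda>C. C - M) ` X)"
  unfolding fits_def by blast

text \<open>
  Passing from the blocks of two stacked diagrams to the connected components of their union
  imposes no further condition on a labelling.
\<close>

lemma fits_quotient_trancl:
  "fits g (\<Union>X // {(x, y). \<exists>B\<in>X. x \<in> B \<and> y \<in> B}\<^sup>+) \<longleftrightarrow> fits g X"
  (is "fits g (_ // ?r\<^sup>+) \<longleftrightarrow> _")
proof
  assume Q: "fits g (\<Union>X // ?r\<^sup>+)"
  show "fits g X"
    unfolding fits_def
  proof (intro ballI)
    fix B x y assume "B \<in> X" "x \<in> B" "y \<in> B"
    then have "?r\<^sup>+ `` {x} \<in> \<Union>X // ?r\<^sup>+" "x \<in> ?r\<^sup>+ `` {x}" "y \<in> ?r\<^sup>+ `` {x}"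
      by (blast intro: quotientI r_into_trancl)+
    then show "g x = g y" using fitsD[OF Q] by blast
  qed
next
  assume X: "fits g X"
  have local_step: "g x = g y" if "(x, y) \<in> ?r" for x y
    using that fitsD[OF X] by blast
  have chain: "g x = g y" if "(x, y) \<in> ?r\<^sup>+" for x y
    using that
  proof (induction rule: trancl_induct)
    case (base y)
    then show ?case by (rule local_step)
  next
    case (step y z)
    then show ?case using local_step[of y z] by simp
  qed
  show "fits g (\<Union>X // ?r\<^sup>+)"
    unfolding fits_def
  proof (intro ballI)
    fix C x y assume "C \<in> \<Union>X // ?r\<^sup>+" and xy: "x \<in> C" "y \<in> C"
    then obtain c where "C = ?r\<^sup>+ `` {c}" by (auto elim: quotientE)
    then have "g c = g x" "g c = g y" using xy by (intro chain; blast)+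
    then show "g x = g y" by simp
  qed
qed

text \<open>
  A labelling that is constant on the blocks is a choice of one label per block. For a block that
  leaves \<open>M\<close> the label is forced by \<open>l\<close>; the blocks inside \<open>M\<close> are free.
\<close>

lemma card_extensions:
  fixes V M :: "'v set" and E :: "'l set"
  assumes P: "partition_on V P" and V: "finite V" and E: "finite E"
    and l: "\<And>x. x \<in> V - M \<Longrightarrow> l x \<in> E" and l_fits: "fits l ((\<lambda>C. C - M) ` P)"
  shows "card {g \<in> V \<rightarrow>\<^sub>E E. fits g P \<and> (\<forall>x\<in>V - M. g x = l x)} = card E ^ card {C \<in> P. C \<subseteq> M}"
    (is "card ?G = _")
proof -
  have finP: "finite P"
    using P V by (rule finite_elements[rotated])
  \<comment> \<open>The admissible labels of a block \<open>C\<close>; a single one if \<open>C\<close> leaves \<open>M\<close>.\<close>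
  define A where "A C = (if C \<subseteq> M then E else l ` (C - M))" for C
  define block where "block x = (THE C. C \<in> P \<and> x \<in> C)" for x
  have block_eq: "block x = C" if "C \<in> P" "x \<in> C" for x C
    unfolding block_def by (rule the_equality) (use that P in \<open>auto simp: partition_on_def disjoint_def\<close>)
  have block: "block x \<in> P" "x \<in> block x" if "x \<in> V" for x
    using that block_eq P by (auto simp: partition_on_def)
  have sub: "x \<in> V" if "C \<in> P" "x \<in> C" for x C
    using that P by (auto simp: partition_on_def)
  have ne: "(SOME x. x \<in> C) \<in> C" if "C \<in> P" for C
    using that P by (metis partition_on_def some_in_eq)
  have l_const: "l x = l y" if "C \<in> P" "x \<in> C - M" "y \<in> C - M" for x y C
    using fitsD[OF l_fits, of "C - M"] that by blast
  have A_E: "A C \<subseteq> E" if "C \<in> P" for C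
    using that l sub by (auto simp: A_def)
  have cardA: "card (A C) = (if C \<subseteq> M then card E else 1)" if "C \<in> P" for C
  proof (cases "C \<subseteq> M")
    case False
    then obtain x where x: "x \<in> C - M" by auto
    then have "l ` (C - M) = {l x}"
      using l_const[OF that] by blast
    then show ?thesis by (simp add: A_def False)
  qed (simp add: A_def)
  have "bij_betw (\<lambda>g. \<lambda>C\<in>P. g (SOME x. x \<in> C)) ?G (Pi\<^sub>E P A)"
  proof (rule bij_betw_byWitness[where f' = "\<lambda>h. \<lambda>x\<in>V. h (block x)"])
    show "\<forall>g\<in>?G. (\<lambda>x\<in>V. (\<lambda>C\<in>P. g (SOME x. x \<in> C)) (block x)) = g"
    proof
      fix g assume g: "g \<in> ?G"
      show "(\<lambda>x\<in>V. (\<lambda>C\<in>P. g (SOME x. x \<in> C)) (block x)) = g"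
      proof
        fix x
        show "(\<lambda>x\<in>V. (\<lambda>C\<in>P. g (SOME x. x \<in> C)) (block x)) x = g x"
        proof (cases "x \<in> V")
          case True
          have "fits g P" using g by simp
          from fitsD[OF this block(1)[OF True] ne[OF block(1)[OF True]] block(2)[OF True]]
          show ?thesis using True block(1)[OF True] by simp
        next
          case False
          have "g \<in> extensional V" using g by (simp add: PiE_def)
          from extensional_arb[OF this False] show ?thesis using False by simp
        qed
      qed
    qed
    show "\<forall>h\<in>Pi\<^sub>E P A. (\<lambda>C\<in>P. (\<lambda>x\<in>V. h (block x)) (SOME x. x \<in> C)) = h"
    proof
      fix h assume h: "h \<in> Pi\<^sub>E P A"
      show "(\<lambda>C\<in>P. (\<lambda>x\<in>V. h (block x)) (SOME x. x \<in> C)) = h"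
      proof
        fix C
        show "(\<lambda>C\<in>P. (\<lambda>x\<in>V. h (block x)) (SOME x. x \<in> C)) C = h C"
          using PiE_arb[OF h, of C] ne[of C] sub[of C] block_eq[of C]
          by (cases "C \<in> P") simp_all
      qed
    qed
    show "(\<lambda>g. \<lambda>C\<in>P. g (SOME x. x \<in> C)) ` ?G \<subseteq> Pi\<^sub>E P A"
    proof clarify
      fix g assume g: "g \<in> V \<rightarrow>\<^sub>E E" "fits g P" "\<forall>x\<in>V - M. g x = l x"
      show "(\<lambda>C\<in>P. g (SOME x. x \<in> C)) \<in> Pi\<^sub>E P A"
      proof
        fix C assume C: "C \<in> P"
        have "g (SOME x. x \<in> C) \<in> A C"
        proof (cases "C \<subseteq> M")
          case True
          then show ?thesis using g(1) ne[OF C] sub[OF C] by (auto simp: A_def)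
        next
          case False
          then obtain x where x: "x \<in> C - M" by auto
          have "g (SOME x. x \<in> C) = g x"
            using fitsD[OF g(2) C ne[OF C]] x by blast
          also have "\<dots> = l x" using g(3) x sub[OF C] by auto
          finally show ?thesis using x False by (auto simp: A_def)
        qed
        then show "(\<lambda>C\<in>P. g (SOME x. x \<in> C)) C \<in> A C" using C by simp
      qed simp
    qed
    show "(\<lambda>h. \<lambda>x\<in>V. h (block x)) ` Pi\<^sub>E P A \<subseteq> ?G"
    proof clarify
      fix h assume h: "h \<in> Pi\<^sub>E P A"
      have 1: "(\<lambda>x\<in>V. h (block x)) \<in> V \<rightarrow>\<^sub>E E"
        using PiE_mem[OF h block(1)] A_E[OF block(1)] by (auto simp: restrict_PiE_iff)
      have 2: "fits (\<lambda>x\<in>V. h (block x)) P"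
        unfolding fits_def using sub block_eq by simp
      have 3: "h (block x) = l x" if "x \<in> V - M" for x
      proof -
        have x: "block x \<in> P" "x \<in> block x - M" using that block by auto
        have "\<not> block x \<subseteq> M" using x(2) by blast
        then have "h (block x) \<in> l ` (block x - M)"
          using PiE_mem[OF h x(1)] by (simp add: A_def)
        then obtain y where "y \<in> block x - M" "h (block x) = l y" by blast
        then show ?thesis using l_const[OF x(1) _ x(2)] by simp
      qed
      show "(\<lambda>x\<in>V. h (block x)) \<in> V \<rightarrow>\<^sub>E E \<and> fits (\<lambda>x\<in>V. h (block x)) P
          \<and> (\<forall>x\<in>V - M. (\<lambda>x\<in>V. h (block x)) x = l x)"
        using 1 2 3 by simp
    qed
  qed
  then have "card ?G = card (Pi\<^sub>E P A)" by (rule bij_betw_same_card)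
  also have "\<dots> = (\<Prod>C\<in>P. if C \<subseteq> M then card E else 1)"
    using finP cardA by (simp add: card_PiE)
  also have "\<dots> = card E ^ card {C \<in> P. C \<subseteq> M}"
    using finP by (simp add: prod.If_cases Int_def)
  finally show ?thesis .
qed


section \<open>Words and matrix entries\<close>

definition words :: "nat \<Rightarrow> nat \<Rightarrow> (nat \<Rightarrow> nat) set" where
  "words n k = {1..k} \<rightarrow>\<^sub>E {..<n}"

fun label :: "(nat \<Rightarrow> nat) \<Rightarrow> (nat \<Rightarrow> nat) \<Rightarrow> (nat \<Rightarrow> nat) \<Rightarrow> vertex \<Rightarrow> nat" where
  "label w u v (Top i) = w i"
| "label w u v (Mid i) = u i"
| "label w u v (Bot i) = v i"

text \<open>
  Diagrams have no vertex in the middle row, so the word \<open>undefined\<close> is never read.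
\<close>

definition matches :: "(nat \<Rightarrow> nat) \<Rightarrow> (nat \<Rightarrow> nat) \<Rightarrow> diagram \<Rightarrow> bool" where
  "matches w v d \<longleftrightarrow> fits (label w undefined v) d"

definition entry :: "nat \<Rightarrow> elt \<Rightarrow> (nat \<Rightarrow> nat) \<Rightarrow> (nat \<Rightarrow> nat) \<Rightarrow> int" where
  "entry n a w v = (\<Sum>d\<in>Poly_Mapping.keys a.
     poly (Poly_Mapping.lookup a d) (of_nat n) * of_bool (matches w v d))"

definition act :: "nat \<Rightarrow> nat \<Rightarrow> elt \<Rightarrow> ((nat \<Rightarrow> nat) \<Rightarrow> int) \<Rightarrow> (nat \<Rightarrow> nat) \<Rightarrow> int" where
  "act n k a f w = (\<Sum>v\<in>words n k. entry n a w v * f v)"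

lemma finite_words [simp]: "finite (words n k)"
  by (simp add: words_def finite_PiE)

lemma Union_diagram: "d \<in> diagrams k \<Longrightarrow> \<Union>d = Top ` {1..k} \<union> Bot ` {1..k}"
  by (auto simp: diagrams_def partition_on_def)

lemma matches_iff_fits:
  assumes "d \<in> diagrams k"
  shows "fits (label w u v) d \<longleftrightarrow> matches w v d"
  unfolding matches_def
  by (rule fits_cong) (use Union_diagram[OF assms] in auto)

text \<open>
  This is where the rule $\rho_1\rho_2 = z^\ell\,\rho_1\circ\rho_2$ comes from: the words on the
  middle row that match both diagrams are the extensions of the labelling \<open>(w, v)\<close> of the outer
  rows to one that is constant on components, and the deleted components are the free ones.
\<close>

lemma card_middle_words:
  assumes d: "d \<in> diagrams k" and e: "e \<in> diagrams k"
    and w: "w \<in> words n k" and v: "v \<in> words n k"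
  shows "card {u \<in> words n k. matches w u d \<and> matches u v e} =
    of_bool (matches w v (compose d e)) * n ^ deleted d e"
proof -
  define V where "V = Top ` {1..k} \<union> Mid ` {1..k} \<union> Bot ` {1..k}"
  let ?P = "components d e"
  let ?U = "{u \<in> words n k. matches w u d \<and> matches u v e}"
  have "\<Union>(stack d e) = upper ` \<Union>d \<union> lower ` \<Union>e"
    unfolding stack_def by auto
  also have "\<dots> = V"
    unfolding Union_diagram[OF d] Union_diagram[OF e] V_def by (simp add: image_Un image_image) blast
  finally have P: "partition_on V ?P"
    unfolding components_def using partition_on_quotient[OF equiv_stack[of "stack d e"]] by simp
  have fits_P: "fits (label w u v) ?P \<longleftrightarrow> matches w u d \<and> matches u v e" for u
  proof -
    have "fits (label w u v \<circ> upper) d \<longleftrightarrow> matches w u d"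
      unfolding matches_def by (rule fits_cong) (use Union_diagram[OF d] in auto)
    moreover have "fits (label w u v \<circ> lower) e \<longleftrightarrow> matches u v e"
      unfolding matches_def by (rule fits_cong) (use Union_diagram[OF e] in auto)
    ultimately show ?thesis
      unfolding components_def fits_quotient_trancl stack_def fits_Un fits_image by simp
  qed
  have outer: "matches w v (compose d e) \<longleftrightarrow> fits (label w u v) ((\<lambda>C. C - range Mid) ` ?P)" for u
  proof -
    have "fits (label w u v) (X - {{}}) \<longleftrightarrow> fits (label w u v) X" for X
      unfolding fits_def by blast
    then show ?thesis
      unfolding matches_iff_fits[OF compose_in_diagrams[OF d e], of w u v, symmetric]
      unfolding compose_def by simp
  qed
  show ?thesis
  proof (cases "matches w v (compose d e)")
    case False
    then have "\<not> fits (label w u v) ?P" for u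
      unfolding outer[of u] by (blast intro: fits_restrict)
    then have "?U = {}" using fits_P by auto
    then show ?thesis using False by simp
  next
    case True
    \<comment> \<open>Words on the middle row are identified with labellings of all three rows that extend
      the given labels of the outer rows.\<close>
    let ?G = "{g \<in> V \<rightarrow>\<^sub>E {..<n}. fits g ?P \<and> (\<forall>x\<in>V - range Mid. g x = label w w v x)}"
    have VP: "\<Union>?P = V" using P by (simp add: partition_on_def)
    have refill: "label w (\<lambda>j\<in>{1..k}. g (Mid j)) v x = g x"
      if "x \<in> V" "\<forall>x\<in>V - range Mid. g x = label w w v x" for g x
    proof -
      have "g x = label w w v x" if "\<And>j. x \<noteq> Mid j"
        using that \<open>x \<in> V\<close> \<open>\<forall>x\<in>V - range Mid. g x = label w w v x\<close> by blast
      then show ?thesis using \<open>x \<in> V\<close> by (cases x) (auto simp: V_def)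
    qed
    have "bij_betw (\<lambda>u. restrict (label w u v) V) ?U ?G"
    proof (rule bij_betw_byWitness[where f' = "\<lambda>g. \<lambda>j\<in>{1..k}. g (Mid j)"])
      show "\<forall>u\<in>?U. (\<lambda>j\<in>{1..k}. restrict (label w u v) V (Mid j)) = u"
      proof (intro ballI ext)
        fix u j assume "u \<in> ?U"
        then have u: "u \<in> words n k" by simp
        show "(\<lambda>j\<in>{1..k}. restrict (label w u v) V (Mid j)) j = u j"
          using PiE_arb[OF u[unfolded words_def], of j] by (cases "j \<in> {1..k}") (auto simp: V_def)
      qed
      show "\<forall>g\<in>?G. restrict (label w (\<lambda>j\<in>{1..k}. g (Mid j)) v) V = g"
      proof (intro ballI ext)
        fix g x assume g: "g \<in> ?G"
        then have gV: "g \<in> V \<rightarrow>\<^sub>E {..<n}" by simp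
        show "restrict (label w (\<lambda>j\<in>{1..k}. g (Mid j)) v) V x = g x"
        proof (cases "x \<in> V")
          case True
          then show ?thesis using refill[of x g] g by simp
        next
          case False
          then show ?thesis using PiE_arb[OF gV False] by simp
        qed
      qed
      show "(\<lambda>u. restrict (label w u v) V) ` ?U \<subseteq> ?G"
      proof clarify
        fix u assume u: "u \<in> words n k" "matches w u d" "matches u v e"
        have "restrict (label w u v) V \<in> V \<rightarrow>\<^sub>E {..<n}"
          using u(1) w v by (auto simp: V_def words_def)
        moreover have "fits (restrict (label w u v) V) ?P"
          using fits_cong[of ?P "restrict (label w u v) V" "label w u v"] fits_P[of u] u VP by simp
        moreover have "restrict (label w u v) V x = label w w v x" if "x \<in> V - range Mid" for x
          using that by (cases x) auto
        ultimately show "restrict (label w u v) V \<in> V \<rightarrow>\<^sub>E {..<n} \<and> fits (restrict (label w u v) V) ?P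
          \<and> (\<forall>x\<in>V - range Mid. restrict (label w u v) V x = label w w v x)" by blast
      qed
      show "(\<lambda>g. \<lambda>j\<in>{1..k}. g (Mid j)) ` ?G \<subseteq> ?U"
      proof clarify
        fix g assume g: "g \<in> V \<rightarrow>\<^sub>E {..<n}" "fits g ?P" "\<forall>x\<in>V - range Mid. g x = label w w v x"
        let ?u = "\<lambda>j\<in>{1..k}. g (Mid j)"
        have "?u \<in> words n k" using g(1) by (auto simp: words_def V_def)
        moreover have "fits (label w ?u v) ?P"
          using fits_cong[of ?P "label w ?u v" g] refill[OF _ g(3)] g(2) VP by simp
        ultimately show "?u \<in> words n k \<and> matches w ?u d \<and> matches ?u v e"
          using fits_P by simp
      qed
    qed
    then have "card ?U = card ?G" by (rule bij_betw_same_card)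
    also have "\<dots> = card {..<n} ^ card {C \<in> ?P. C \<subseteq> range Mid}"
    proof (rule card_extensions[OF P])
      show "finite V" by (simp add: V_def)
      show "label w w v x \<in> {..<n}" if "x \<in> V - range Mid" for x
        using that w v by (auto simp: V_def words_def)
      show "fits (label w w v) ((\<lambda>C. C - range Mid) ` ?P)"
        using True outer by simp
    qed simp
    finally show ?thesis using True by (simp add: deleted_def)
  qed
qed

lemma entry_superset:
  assumes "finite D" "Poly_Mapping.keys a \<subseteq> D"
  shows "entry n a w v =
    (\<Sum>d\<in>D. poly (Poly_Mapping.lookup a d) (of_nat n) * of_bool (matches w v d))"
  unfolding entry_def
  by (rule sum.mono_neutral_left) (use assms in \<open>auto simp: in_keys_iff\<close>)

lemma entry_add: "entry n (a + b) w v = entry n a w v + entry n b w v"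
proof -
  let ?D = "Poly_Mapping.keys a \<union> Poly_Mapping.keys b"
  have D: "finite ?D" "Poly_Mapping.keys (a + b) \<subseteq> ?D" "Poly_Mapping.keys a \<subseteq> ?D"
    "Poly_Mapping.keys b \<subseteq> ?D"
    using keys_add[of a b] by auto
  show ?thesis
    unfolding entry_superset[OF D(1,2)] entry_superset[OF D(1,3)] entry_superset[OF D(1,4)]
    by (simp add: lookup_add sum.distrib distrib_right del: sum_mult_of_bool_eq)
qed

lemma entry_0: "entry n 0 w v = 0"
  by (simp add: entry_def)

lemma entry_uminus: "entry n (- a) w v = - entry n a w v"
  using entry_add[of n a "- a" w v] by (simp add: entry_0)

lemma entry_sum: "entry n (\<Sum>x\<in>X. F x) w v = (\<Sum>x\<in>X. entry n (F x) w v)"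
  by (induction X rule: infinite_finite_induct) (simp_all add: entry_0 entry_add)

lemma entry_single:
  "entry n (Poly_Mapping.single d c) w v = poly c (of_nat n) * of_bool (matches w v d)"
  by (simp add: entry_def)

lemma entry_mult:
  assumes a: "a \<in> partition_algebra k" and b: "b \<in> partition_algebra k"
    and w: "w \<in> words n k" and v: "v \<in> words n k"
  shows "entry n (a \<odot> b) w v = (\<Sum>u\<in>words n k. entry n a w u * entry n b u v)"
proof -
  let ?c = "\<lambda>x d. poly (Poly_Mapping.lookup x d) (of_nat n) :: int"
  have mid: "of_nat n ^ deleted d e * of_bool (matches w v (compose d e)) =
      (\<Sum>u\<in>words n k. of_bool (matches w u d) * of_bool (matches u v e) :: int)"
    if "d \<in> Poly_Mapping.keys a" "e \<in> Poly_Mapping.keys b" for d e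
  proof -
    have de: "d \<in> diagrams k" "e \<in> diagrams k"
      using that a b by (auto simp: partition_algebra_def)
    have "(\<Sum>u\<in>words n k. of_bool (matches w u d) * of_bool (matches u v e) :: int)
        = int (card {u \<in> words n k. matches w u d \<and> matches u v e})"
      by (simp add: of_bool_conj[symmetric] Int_def del: of_bool_conj)
    then show ?thesis
      unfolding card_middle_words[OF de w v] by simp
  qed
  have "entry n (a \<odot> b) w v = (\<Sum>d\<in>Poly_Mapping.keys a. \<Sum>e\<in>Poly_Mapping.keys b.
      ?c a d * ?c b e * (of_nat n ^ deleted d e * of_bool (matches w v (compose d e))))"
    unfolding pmult_def entry_sum entry_single
    by (intro sum.cong) (simp_all add: poly_monom mult_ac)
  also have "\<dots> = (\<Sum>d\<in>Poly_Mapping.keys a. \<Sum>e\<in>Poly_Mapping.keys b. \<Sum>u\<in>words n k.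
      (?c a d * of_bool (matches w u d)) * (?c b e * of_bool (matches u v e)))"
    by (intro sum.cong refl) (simp add: mid sum_distrib_left mult_ac)
  also have "\<dots> = (\<Sum>d\<in>Poly_Mapping.keys a. \<Sum>u\<in>words n k. \<Sum>e\<in>Poly_Mapping.keys b.
      (?c a d * of_bool (matches w u d)) * (?c b e * of_bool (matches u v e)))"
    by (intro sum.cong refl sum.swap)
  also have "\<dots> = (\<Sum>u\<in>words n k. \<Sum>d\<in>Poly_Mapping.keys a. \<Sum>e\<in>Poly_Mapping.keys b.
      (?c a d * of_bool (matches w u d)) * (?c b e * of_bool (matches u v e)))"
    by (rule sum.swap)
  also have "\<dots> = (\<Sum>u\<in>words n k. entry n a w u * entry n b u v)"
    by (simp only: entry_def sum_product)
  finally show ?thesis .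
qed

text \<open>
  Suppose that a nonzero element has the zero matrix for every \<open>n\<close>, and take a finest diagram \<open>d\<close>
  in its support. Label the vertices so that two of them share a letter exactly if they
  share a block of \<open>d\<close>; this takes \<open>card d\<close> letters. Only diagrams that refine \<open>d\<close> match these
  words, so the matrix entry is the coefficient of \<open>d\<close> evaluated at \<open>n\<close>, for every
  \<open>n \<ge> card d\<close>.
\<close>

lemma entry_faithful:
  assumes a: "a \<in> partition_algebra k" and b: "b \<in> partition_algebra k"
    and eq: "\<And>n w v. w \<in> words n k \<Longrightarrow> v \<in> words n k \<Longrightarrow> entry n a w v = entry n b w v"
  shows "a = b"
proof (rule ccontr)
  assume "a \<noteq> b"
  define c where "c = a - b"
  have c: "c \<in> partition_algebra k"
    unfolding c_def by (rule partition_algebra_diff[OF a b])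
  have zero: "entry n c w v = 0" if "w \<in> words n k" "v \<in> words n k" for n w v
    using eq[OF that] entry_add[of n a "- b" w v] by (simp add: c_def entry_uminus)
  \<comment> \<open>Diagrams are compared through their equivalence relations: if \<open>e\<close> refines \<open>d\<close>, then
    \<open>rel e \<subseteq> rel d\<close>, so a relation of least cardinality belongs to a finest diagram.\<close>
  define rel :: "diagram \<Rightarrow> (vertex \<times> vertex) set" where "rel d = (\<Union>B\<in>d. B \<times> B)" for d
  have "Poly_Mapping.keys c \<noteq> {}" using \<open>a \<noteq> b\<close> by (simp add: c_def)
  then obtain d where d: "d \<in> Poly_Mapping.keys c"
      and least: "\<And>e. e \<in> Poly_Mapping.keys c \<Longrightarrow> card (rel d) \<le> card (rel e)"
    using ex_has_least_nat[of "\<lambda>d. d \<in> Poly_Mapping.keys c" _ "\<lambda>d. card (rel d)"] by blast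
  define V where "V = Top ` {1..k} \<union> Bot ` {1..k}"
  have part: "partition_on V e" if "e \<in> Poly_Mapping.keys c" for e
    using that c by (auto simp: partition_algebra_def diagrams_def V_def)
  have finV: "finite V" by (simp add: V_def)
  have rel_sub: "rel e \<subseteq> V \<times> V" if "e \<in> Poly_Mapping.keys c" for e
    using part[OF that] by (auto simp: rel_def partition_on_def)
  have rel_block: "e = (\<lambda>x. rel e `` {x}) ` V" if "e \<in> Poly_Mapping.keys c" for e
  proof -
    have "rel e `` {x} = B" if "B \<in> e" "x \<in> B" for B x
      using that part[OF \<open>e \<in> _\<close>] by (auto simp: rel_def partition_on_def disjoint_def)
    moreover have "\<exists>x\<in>V. x \<in> B" if "B \<in> e" for B
      using that part[OF \<open>e \<in> _\<close>] by (metis UnionI ex_in_conv partition_on_def)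
    moreover have "\<exists>B\<in>e. x \<in> B" if "x \<in> V" for x
      using that part[OF \<open>e \<in> _\<close>] by (auto simp: partition_on_def)
    ultimately show ?thesis by (auto simp: image_iff) metis+
  qed
  have "finite d" using finite_elements[OF finV part[OF d]] .
  obtain h where h: "bij_betw h d {0..<card d}"
    using ex_bij_betw_finite_nat[OF \<open>finite d\<close>] by blast
  define g where "g x = h (rel d `` {x})" for x
  have g_less: "g x < card d" if "x \<in> V" for x
  proof -
    have "rel d `` {x} \<in> d" using rel_block[OF d] that by blast
    then show ?thesis using h by (auto simp: g_def bij_betw_def)
  qed
  have g_eq: "(x, y) \<in> rel d" if "x \<in> V" "y \<in> V" "g x = g y" for x y
  proof -
    have "rel d `` {x} \<in> d" "rel d `` {y} \<in> d" using rel_block[OF d] that by blast+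
    then have "rel d `` {x} = rel d `` {y}"
      using h that(3) by (auto simp: g_def bij_betw_def inj_on_def)
    moreover have "(y, y) \<in> rel d"
      using part[OF d] that(2) by (auto simp: rel_def partition_on_def)
    ultimately show ?thesis by blast
  qed
  have g_const: "g x = g y" if "B \<in> d" "x \<in> B" "y \<in> B" for B x y
  proof -
    have "rel d `` {x} = B" "rel d `` {y} = B"
      using that part[OF d] by (auto simp: rel_def partition_on_def disjoint_def)
    then show ?thesis by (simp add: g_def)
  qed
  define w where "w = (\<lambda>j\<in>{1..k}. g (Top j))"
  define v where "v = (\<lambda>j\<in>{1..k}. g (Bot j))"
  have lab: "label w u v x = g x" if "x \<in> V" for u x
    using that by (auto simp: V_def w_def v_def)
  have match: "matches w v e \<longleftrightarrow> e = d" if e: "e \<in> Poly_Mapping.keys c" for e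
  proof
    assume "matches w v e"
    then have "fits g e"
      unfolding matches_def using fits_cong[of e _ g] lab part[OF e]
      by (metis partition_on_def)
    then have "rel e \<subseteq> rel d"
    proof -
      have "(x, y) \<in> rel d" if "B \<in> e" "x \<in> B" "y \<in> B" for B x y
        using that part[OF e] fitsD[OF \<open>fits g e\<close>] g_eq by (metis UnionI partition_on_def)
      then show ?thesis unfolding rel_def[of e] by blast
    qed
    moreover have "finite (rel d)" using rel_sub[OF d] finV by (meson finite_SigmaI finite_subset)
    ultimately have "rel e = rel d" using least[OF e] by (simp add: card_seteq)
    then show "e = d" using rel_block[OF e] rel_block[OF d] by simp
  next
    assume "e = d"
    have "fits g d" unfolding fits_def using g_const by blast
    then show "matches w v e"
      unfolding matches_def \<open>e = d\<close> using fits_cong[of d _ g] lab part[OF d]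
      by (metis partition_on_def)
  qed
  have "poly (Poly_Mapping.lookup c d) (of_nat n) = 0" if "card d \<le> n" for n
  proof -
    have "w \<in> words n k" "v \<in> words n k"
      using g_less that by (auto simp: words_def w_def v_def V_def intro: less_le_trans)
    then have "0 = entry n c w v" using zero by simp
    also have "\<dots> = (\<Sum>e\<in>Poly_Mapping.keys c.
        if e = d then poly (Poly_Mapping.lookup c e) (of_nat n) else 0)"
      unfolding entry_def by (intro sum.cong) (auto simp: match)
    also have "\<dots> = poly (Poly_Mapping.lookup c d) (of_nat n)"
      using d by simp
    finally show ?thesis by simp
  qed
  then have "of_nat ` {card d..} \<subseteq> {x. poly (Poly_Mapping.lookup c d) x = 0}" by auto
  moreover have "infinite (of_nat ` {card d..} :: int set)"
    by (simp add: finite_image_iff infinite_Ici)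
  ultimately have "Poly_Mapping.lookup c d = 0"
    using poly_roots_finite finite_subset by blast
  then show False using d by (simp add: in_keys_iff)
qed



section \<open>The action on functions of words\<close>

lemma act_mult:
  assumes "a \<in> partition_algebra k" "b \<in> partition_algebra k" "w \<in> words n k"
  shows "act n k (a \<odot> b) f w = act n k a (act n k b f) w"
proof -
  have "act n k (a \<odot> b) f w =
      (\<Sum>v\<in>words n k. \<Sum>u\<in>words n k. entry n a w u * (entry n b u v * f v))"
    unfolding act_def
    by (intro sum.cong refl) (simp add: entry_mult[OF assms] sum_distrib_right mult.assoc)
  also have "\<dots> = (\<Sum>u\<in>words n k. \<Sum>v\<in>words n k. entry n a w u * (entry n b u v * f v))"
    by (rule sum.swap)
  finally show ?thesis by (simp add: act_def sum_distrib_left)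
qed

lemma act_add: "act n k (a + b) f w = act n k a f w + act n k b f w"
  by (simp add: act_def entry_add distrib_right sum.distrib)

lemma act_uminus: "act n k (- a) f w = - act n k a f w"
  by (simp add: act_def entry_uminus sum_negf)

lemma act_diff: "act n k (a - b) f w = act n k a f w - act n k b f w"
  using act_add[of n k a "- b" f w] act_uminus[of n k b f w] by simp

lemma entry_eq_act:
  assumes "v \<in> words n k"
  shows "entry n a w v = act n k a (\<lambda>u. of_bool (u = v)) w"
proof -
  have "act n k a (\<lambda>u. of_bool (u = v)) w = (\<Sum>u\<in>words n k. if u = v then entry n a w u else 0)"
    unfolding act_def by (intro sum.cong) auto
  then show ?thesis using assms by simp
qed

lemma act_faithful:
  assumes "a \<in> partition_algebra k" "b \<in> partition_algebra k"
    and "\<And>n f w. w \<in> words n k \<Longrightarrow> act n k a f w = act n k b f w"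
  shows "a = b"
  using assms(1,2) by (rule entry_faithful) (simp only: entry_eq_act[where k = k] assms(3))

lemma act_basis: "act n k (basis d) f w = sum f {v \<in> words n k. matches w v d}"
  by (simp add: act_def basis_def entry_single Int_def conj_commute)

lemma matches_Un: "matches w v (d \<union> e) \<longleftrightarrow> matches w v d \<and> matches w v e"
  by (simp add: matches_def fits_Un)

lemma matches_empty: "matches w v {}"
  by (simp add: matches_def fits_def)

text \<open>
  Comparing all vertices of a block with one of them, instead of comparing all pairs, gives
  equations that can be used for rewriting without looping.
\<close>

lemma matches_insert:
  "matches w v (insert (insert x B) d) \<longleftrightarrow>
    (\<forall>y\<in>B. label w undefined v y = label w undefined v x) \<and> matches w v d"
proof -
  have "fits g (insert (insert x B) d) \<longleftrightarrow> (\<forall>y\<in>B. g y = g x) \<and> fits g d"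
    (is "_ \<longleftrightarrow> ?R") for g :: "vertex \<Rightarrow> nat"
  proof
    assume f: "fits g (insert (insert x B) d)"
    have "g y = g x" if "y \<in> B" for y
      by (rule fitsD[OF f, of "insert x B"]) (simp_all add: that)
    then show ?R using f fits_Un[of g "{insert x B}" d] by simp
  next
    assume R: ?R
    then have gx: "g y = g x" if "y \<in> insert x B" for y
      using that by blast
    have "g y = g z" if "y \<in> insert x B" "z \<in> insert x B" for y z
      using gx[OF that(1)] gx[OF that(2)] by metis
    then have "fits g {insert x B}" unfolding fits_def by blast
    then show "fits g (insert (insert x B) d)"
      using R fits_Un[of g "{insert x B}" d] by simp
  qed
  then show ?thesis by (simp add: matches_def)
qed

lemma matches_strands: "matches w v (strands M) \<longleftrightarrow> (\<forall>m\<in>M. w m = v m)"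
proof -
  let ?l = "label w undefined v"
  have "(\<forall>x\<in>{Top m, Bot m}. \<forall>y\<in>{Top m, Bot m}. ?l x = ?l y) \<longleftrightarrow> w m = v m" for m
    by auto
  then show ?thesis
    unfolding matches_def fits_def strands_def by (simp only: ball_simps)
qed

lemmas matches_simps = matches_Un matches_empty matches_insert matches_strands

lemma words_eqI:
  assumes "w \<in> words n k" "v \<in> words n k" "\<And>j. j \<in> {1..k} \<Longrightarrow> w j = v j"
  shows "w = v"
  using assms unfolding words_def by (rule PiE_ext)

lemma words_upd: "w \<in> words n k \<Longrightarrow> 1 \<le> j \<Longrightarrow> j \<le> k \<Longrightarrow> c < n \<Longrightarrow> w(j := c) \<in> words n k"
  by (auto simp: words_def PiE_iff extensional_def)

lemma words_less: "w \<in> words n k \<Longrightarrow> 1 \<le> j \<Longrightarrow> j \<le> k \<Longrightarrow> w j < n"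
  unfolding words_def by auto

lemma act_one:
  assumes "w \<in> words n k"
  shows "act n k (one k) f w = f w"
proof -
  have "v = w" if "v \<in> words n k" "matches w v (strands {1..k})" for v
    by (rule words_eqI[OF that(1) assms]) (use that(2) in \<open>simp add: matches_strands\<close>)
  then have "{v \<in> words n k. matches w v (strands {1..k})} = {w}"
    using assms by (auto simp: matches_strands)
  then show ?thesis by (simp add: one_def act_basis)
qed

lemma act_s:
  assumes w: "w \<in> words n k" and i: "1 \<le> i" "i < k"
  shows "act n k (s k i) f w = f (w(i := w (Suc i), Suc i := w i))"
proof -
  let ?w = "w(i := w (Suc i), Suc i := w i)"
  let ?d = "{{Top i, Bot (i + 1)}, {Top (i + 1), Bot i}} \<union> strands ({1..k} - {i, i + 1})"
  have "?w \<in> words n k" using w i by (intro words_upd words_less) auto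
  moreover have "v = ?w" if "v \<in> words n k" "matches w v ?d" for v
    by (rule words_eqI[OF that(1) \<open>?w \<in> _\<close>]) (use that(2) in \<open>simp add: matches_simps\<close>)
  moreover have "matches w ?w ?d" by (simp add: matches_simps)
  ultimately have "{v \<in> words n k. matches w v ?d} = {?w}" by blast
  then show ?thesis by (simp add: s_def act_basis)
qed

lemma act_p:
  assumes w: "w \<in> words n k" and j: "1 \<le> j" "j \<le> k"
  shows "act n k (p k j) f w = (\<Sum>c<n. f (w(j := c)))"
proof -
  let ?d = "{{Top j}, {Bot j}} \<union> strands ({1..k} - {j})"
  have "v = w(j := v j)" if "v \<in> words n k" "matches w v ?d" for v
    using that(1) words_upd[OF w j words_less[OF that(1) j]]
    by (rule words_eqI) (use that(2) in \<open>simp add: matches_simps\<close>)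
  moreover have "matches w (w(j := c)) ?d" for c by (simp add: matches_simps)
  ultimately have "{v \<in> words n k. matches w v ?d} = (\<lambda>c. w(j := c)) ` {..<n}"
    using words_upd[OF w j] words_less[OF _ j] by blast
  moreover have "inj_on (\<lambda>c. w(j := c)) {..<n}"
    by (rule inj_onI) (metis fun_upd_same)
  ultimately show ?thesis by (simp add: p_def act_basis sum.reindex)
qed

lemma act_p_half:
  assumes w: "w \<in> words n k" and i: "1 \<le> i" "i < k"
  shows "act n k (p_half k i) f w = (if w i = w (Suc i) then f w else 0)"
proof -
  let ?d = "{{Top i, Top (i + 1), Bot i, Bot (i + 1)}} \<union> strands ({1..k} - {i, i + 1})"
  have "v = w \<and> w i = w (Suc i)" if "v \<in> words n k" "matches w v ?d" for v
  proof
    show "v = w"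
    proof (rule words_eqI[OF that(1) w])
      fix j assume "j \<in> {1..k}"
      then show "v j = w j"
        using that(2) by (cases "j = i \<or> j = Suc i") (auto simp: matches_simps)
    qed
    show "w i = w (Suc i)" using that(2) by (simp add: matches_simps)
  qed
  moreover have "matches w w ?d \<longleftrightarrow> w i = w (Suc i)" by (auto simp: matches_simps)
  ultimately have "{v \<in> words n k. matches w v ?d} = (if w i = w (Suc i) then {w} else {})"
    using w by auto
  then show ?thesis by (simp add: p_half_def act_basis)
qed


section \<open>Transposing letters in a prefix\<close>

text \<open>
  Unlike the diagrams of permutations, which permute the positions of a word, this renames its
  letters. It will be used with \<open>a\<close> and \<open>b\<close> read off from \<open>w\<close> itself.
\<close>

definition relabel :: "nat \<Rightarrow> nat \<Rightarrow> nat \<Rightarrow> (nat \<Rightarrow> nat) \<Rightarrow> nat \<Rightarrow> nat" where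
  "relabel m a b w = (\<lambda>j. if j \<in> {1..m} then transpose a b (w j) else w j)"

lemma relabel_refl [simp]: "relabel m a a w = w"
  by (simp add: relabel_def fun_eq_iff)

lemma relabel_commute: "relabel m a b = relabel m b a"
  by (simp add: relabel_def fun_eq_iff transpose_commute)

lemma relabel_words:
  "w \<in> words n k \<Longrightarrow> a < n \<Longrightarrow> b < n \<Longrightarrow> m \<le> k \<Longrightarrow> relabel m a b w \<in> words n k"
  by (auto simp: relabel_def words_def PiE_iff extensional_def transpose_def)

text \<open>
  The generators that occur in one step of the recursions touch two or three adjacent positions.
  \<open>window i x r\<close> is the word \<open>x\<close> with the letters of \<open>r\<close> written at the positions from \<open>i\<close> on. In
  this form the action of each generator becomes a rewrite rule on the list \<open>r\<close>.
\<close>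

primrec window :: "nat \<Rightarrow> (nat \<Rightarrow> nat) \<Rightarrow> nat list \<Rightarrow> nat \<Rightarrow> nat" where
  "window i x [] = x"
| "window i x (a # r) = (window (Suc i) x r)(i := a)"

declare window.simps(2) [simp del]

lemma window_Cons [simp]: "window i x (a # r) i = a"
  by (simp add: window.simps)

lemma window_Cons_Cons [simp]: "window i x (a # b # r) (Suc i) = b"
  by (simp add: window.simps)

lemma window_Cons_Cons_Cons [simp]: "window i x (a # b # c # r) (Suc (Suc i)) = c"
  by (simp add: window.simps)

lemma window_words:
  "x \<in> words n k \<Longrightarrow> 1 \<le> i \<Longrightarrow> i + length r \<le> Suc k \<Longrightarrow> \<forall>a\<in>set r. a < n \<Longrightarrow> window i x r \<in> words n k"
  by (induction r arbitrary: i) (simp_all add: window.simps words_upd)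

lemma window2_self: "window i w [w i, w (Suc i)] = w"
  by (simp add: window.simps)

lemma window3_self: "window i w [w i, w (Suc i), w (Suc (Suc i))] = w"
  by (simp add: window.simps)

lemma window_nth:
  "window i x r j = (if i \<le> j \<and> j < i + length r then r ! (j - i) else x j)"
proof (induction r arbitrary: i)
  case (Cons a r)
  show ?case
    unfolding window.simps using Cons.IH[of "Suc i"] by (auto simp: nth_Cons' Suc_le_eq)
qed simp

lemma relabel_window_append:
  assumes "1 \<le> i"
  shows "relabel (i - 1 + length q) u v (window i x (q @ r)) =
    window i (relabel (i - 1) u v x) (map (transpose u v) q @ r)"
proof
  fix j
  show "relabel (i - 1 + length q) u v (window i x (q @ r)) j =
    window i (relabel (i - 1) u v x) (map (transpose u v) q @ r) j"
    using assms by (auto simp: relabel_def window_nth nth_append)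
qed

lemma relabel_window:
  assumes "1 \<le> i"
  shows "relabel (i - 1) u v (window i x r) = window i (relabel (i - 1) u v x) r"
    and "relabel i u v (window i x (a # r)) =
      window i (relabel (i - 1) u v x) (transpose u v a # r)"
    and "relabel (Suc i) u v (window i x (a # b # r)) =
      window i (relabel (i - 1) u v x) (transpose u v a # transpose u v b # r)"
    and "relabel (Suc (Suc i)) u v (window i x (a # b # c # r)) =
      window i (relabel (i - 1) u v x) (transpose u v a # transpose u v b # transpose u v c # r)"
  using assms relabel_window_append[OF assms, of "[]" u v x r]
    relabel_window_append[OF assms, of "[a]" u v x r]
    relabel_window_append[OF assms, of "[a, b]" u v x r]
    relabel_window_append[OF assms, of "[a, b, c]" u v x r]
  by simp_all

text \<open>
  The generators act by substitution into a function of words, so that a product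
  \<open>a \<odot> b\<close> first performs on the word the substitution of its left factor \<open>a\<close>.
\<close>

lemma act_s_window:
  assumes "window i x (a # b # r) \<in> words n k" "1 \<le> i" "i < k"
  shows "act n k (s k i) f (window i x (a # b # r)) = f (window i x (b # a # r))"
  unfolding act_s[OF assms]
  by (rule arg_cong[of _ _ f]) (auto simp: window.simps fun_eq_iff)

lemma act_s_window_Suc:
  assumes "window i x (a # b # c # r) \<in> words n k" "Suc i < k"
  shows "act n k (s k (Suc i)) f (window i x (a # b # c # r)) = f (window i x (a # c # b # r))"
proof -
  have "1 \<le> Suc i" by simp
  from act_s[OF assms(1) this assms(2)] show ?thesis
    by (simp add: window.simps fun_upd_twist)
qed

lemma act_p_window_Suc:
  assumes "window i x (a # b # r) \<in> words n k" "Suc i \<le> k"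
  shows "act n k (p k (Suc i)) f (window i x (a # b # r)) = (\<Sum>c<n. f (window i x (a # c # r)))"
proof -
  have "1 \<le> Suc i" by simp
  from act_p[OF assms(1) this assms(2)] show ?thesis
    by (simp add: window.simps fun_upd_twist)
qed

lemma act_p_half_window:
  assumes "window i x (a # b # r) \<in> words n k" "1 \<le> i" "i < k"
  shows "act n k (p_half k i) f (window i x (a # b # r)) =
    (if a = b then f (window i x (a # b # r)) else 0)"
  unfolding act_p_half[OF assms] by simp

lemma act_p_half_window_Suc:
  assumes "window i x (a # b # c # r) \<in> words n k" "Suc i < k"
  shows "act n k (p_half k (Suc i)) f (window i x (a # b # c # r)) =
    (if b = c then f (window i x (a # b # c # r)) else 0)"
  using act_p_half[OF assms(1) _ assms(2)] by simp

lemmas act_window =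
  act_s_window act_s_window_Suc act_p_window_Suc act_p_half_window act_p_half_window_Suc


section \<open>The recursions\<close>

text \<open>
  The roles of $L_i$ and of the two families of $\sigma$: the prefix length \<open>m\<close> is \<open>i + 1\<close> for
  $\sigma_{i+1}$ and \<open>i - 1\<close> for $\sigma_{i+\frac12}$.
\<close>

definition L_action :: "nat \<Rightarrow> nat \<Rightarrow> nat \<Rightarrow> elt \<Rightarrow> bool" where
  "L_action n k i a \<longleftrightarrow>
    (\<forall>f. \<forall>w\<in>words n k. act n k a f w = (\<Sum>d<n. f (relabel i (w i) d w)))"

definition swap_action :: "nat \<Rightarrow> nat \<Rightarrow> nat \<Rightarrow> nat \<Rightarrow> elt \<Rightarrow> bool" where
  "swap_action n k m i a \<longleftrightarrow>
    (\<forall>f. \<forall>w\<in>words n k. act n k a f w = f (relabel m (w i) (w (Suc i)) w))"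

lemma L_action_window:
  assumes "L_action n k i l" "1 \<le> i" "window i x (a # r) \<in> words n k"
  shows "act n k l f (window i x (a # r)) =
    (\<Sum>d<n. f (window i (relabel (i - 1) a d x) (d # r)))"
  using assms by (simp add: L_action_def relabel_window)

lemma swap_action_window:
  assumes "1 \<le> i" "window i x (a # b # r) \<in> words n k"
  shows "swap_action n k (Suc i) i \<sigma> \<Longrightarrow> act n k \<sigma> f (window i x (a # b # r)) =
      f (window i (relabel (i - 1) a b x) (b # a # r))"
    and "swap_action n k (i - 1) i \<sigma> \<Longrightarrow> act n k \<sigma> f (window i x (a # b # r)) =
      f (window i (relabel (i - 1) a b x) (a # b # r))"
  using assms by (simp_all add: swap_action_def relabel_window[simplified])

lemmas act_algebra =
  act_add act_diff act_uminus act_mult partition_algebra_mult partition_algebra_add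
  partition_algebra_diff partition_algebra_uminus s_in p_in p_half_in

text \<open>
  Write \<open>a\<close> and \<open>b\<close> for the letters at positions \<open>i\<close> and \<open>i + 1\<close>. If \<open>a \<noteq> b\<close>, the second and the
  third summand vanish; the fourth is the desired sum except that the transposition $(b\,d)$ is not applied to
  the letter \<open>a\<close> at position \<open>i\<close>. This matters only for \<open>d = a\<close>, and there the first summand removes
  the wrong word and \<open>\<sigma>\<close> supplies the right one. If \<open>a = b\<close>, the third summand alone is the desired
  sum; the second cancels the fourth and the first cancels \<open>\<sigma>\<close>.
\<close>

lemma L_rec_action:
  assumes mem: "l \<in> partition_algebra k" "\<sigma> \<in> partition_algebra k"
    and l: "L_action n k i l" and \<sigma>: "swap_action n k (Suc i) i \<sigma>"
    and i: "1 \<le> i" "i < k"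
  shows "L_action n k (Suc i) (L_rec k i l \<sigma>)"
  unfolding L_action_def
proof (intro allI ballI)
  fix f :: "(nat \<Rightarrow> nat) \<Rightarrow> int" and w assume w: "w \<in> words n k"
  define m a b where "m = i - 1" and "a = w i" and "b = w (Suc i)"
  note window_simps = relabel_window[OF i(1), folded m_def]
    L_action_window[OF l i(1), folded m_def] swap_action_window(1)[OF i(1) _ \<sigma>, folded m_def]
  have ab: "a < n" "b < n" using w i by (auto simp: a_def b_def intro: words_less)
  have m: "m \<le> k" using i by (simp add: m_def)
  let ?f = "\<lambda>c d r. f (window i (relabel m c d w) r)"
  have "act n k (L_rec k i l \<sigma>) f (window i w [a, b]) =
      (if a = b then \<Sum>d<n. ?f b d [d, d]
       else (\<Sum>d<n. ?f b d [a, d]) - ?f a b [a, a] + ?f a b [b, a])"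
    unfolding L_rec_def using w i ab m
    by (simp add: act_algebra mem act_window window_simps window_words relabel_words
        relabel_commute cong: sum.cong_simp)
  also have "\<dots> = (\<Sum>d<n. ?f b d [transpose b d a, d])"
  proof (cases "a = b")
    case False
    have "?f b d [transpose b d a, d] =
        ?f b d [a, d] + (if d = a then ?f a b [b, a] - ?f a b [a, a] else 0)" for d
      using False by (simp add: relabel_commute)
    then show ?thesis using False ab by (simp add: sum.distrib)
  qed simp
  also have "\<dots> = (\<Sum>d<n. f (relabel (Suc i) b d (window i w [a, b])))"
    by (simp add: window_simps)
  finally show "act n k (L_rec k i l \<sigma>) f w = (\<Sum>d<n. f (relabel (Suc i) (w (Suc i)) d w))"
    by (simp add: a_def b_def window2_self)
qed

text \<open>
  Let \<open>a, b, c\<close> be the letters at positions \<open>i, i + 1, i + 2\<close>. The first summand, a conjugate of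
  \<open>\<sigma>\<close>, applies $(b\,c)$ before position \<open>i\<close> and exchanges \<open>b\<close> and \<open>c\<close>, but it does not apply
  $(b\,c)$ to \<open>a\<close>. That is wrong only if \<open>a\<close> is \<open>b\<close> or \<open>c\<close>. The second summand is nonzero only for
  \<open>a = c\<close>, and the third only for \<open>a = b\<close>; each then gives the right word. The fourth (for \<open>a = c\<close>)
  and the fifth (for \<open>a = b\<close>) remove the wrong one.
\<close>

lemma sigma_rec_action:
  assumes mem: "l \<in> partition_algebra k" "\<sigma> \<in> partition_algebra k"
    and l: "L_action n k i l" and \<sigma>: "swap_action n k (Suc i) i \<sigma>"
    and i: "1 \<le> i" "Suc i < k"
  shows "swap_action n k (Suc (Suc i)) (Suc i) (sigma_rec k (Suc i) \<sigma> l)"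
  unfolding swap_action_def
proof (intro allI ballI)
  fix f :: "(nat \<Rightarrow> nat) \<Rightarrow> int" and w assume w: "w \<in> words n k"
  define m a b c where "m = i - 1" and "a = w i" and "b = w (Suc i)" and "c = w (Suc (Suc i))"
  note window_simps = relabel_window[OF i(1), folded m_def]
    L_action_window[OF l i(1), folded m_def] swap_action_window(1)[OF i(1) _ \<sigma>, folded m_def]
  have abc: "a < n" "b < n" "c < n" using w i by (auto simp: a_def b_def c_def intro: words_less)
  have m: "m \<le> k" using i by (simp add: m_def)
  have "act n k (sigma_rec k (Suc i) \<sigma> l) f (window i w [a, b, c]) =
      f (relabel (Suc (Suc i)) b c (window i w [a, b, c]))"
    unfolding sigma_rec_def using w i abc m
    by (simp add: act_algebra mem act_window window_simps window_words relabel_words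
        relabel_commute cong: sum.cong_simp)
  then show "act n k (sigma_rec k (Suc i) \<sigma> l) f w =
      f (relabel (Suc (Suc i)) (w (Suc i)) (w (Suc (Suc i))) w)"
    by (simp add: a_def b_def c_def window3_self)
qed

text \<open>
  The mechanism is the same as for \<open>sigma_rec_action\<close>. The conjugation now leaves \<open>b\<close> and \<open>c\<close> in
  place, and the second and fourth summands correct the case \<open>a = b\<close>, the third and fifth the case
  \<open>a = c\<close>.
\<close>

lemma sigma_half_rec_action:
  assumes mem: "l \<in> partition_algebra k" "\<sigma> \<in> partition_algebra k"
    and l: "L_action n k i l" and \<sigma>: "swap_action n k (i - 1) i \<sigma>"
    and i: "1 \<le> i" "Suc i < k"
  shows "swap_action n k i (Suc i) (sigma_half_rec k (Suc i) \<sigma> l)"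
  unfolding swap_action_def
proof (intro allI ballI)
  fix f :: "(nat \<Rightarrow> nat) \<Rightarrow> int" and w assume w: "w \<in> words n k"
  define m a b c where "m = i - 1" and "a = w i" and "b = w (Suc i)" and "c = w (Suc (Suc i))"
  note window_simps = relabel_window[OF i(1), folded m_def]
    L_action_window[OF l i(1), folded m_def] swap_action_window(2)[OF i(1) _ \<sigma>, folded m_def]
  have abc: "a < n" "b < n" "c < n" using w i by (auto simp: a_def b_def c_def intro: words_less)
  have m: "m \<le> k" using i by (simp add: m_def)
  have "act n k (sigma_half_rec k (Suc i) \<sigma> l) f (window i w [a, b, c]) =
      f (relabel i b c (window i w [a, b, c]))"
    unfolding sigma_half_rec_def using w i abc m
    by (simp add: act_algebra mem act_window window_simps window_words relabel_words
        relabel_commute cong: sum.cong_simp)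
  then show "act n k (sigma_half_rec k (Suc i) \<sigma> l) f w =
      f (relabel i (w (Suc i)) (w (Suc (Suc i))) w)"
    by (simp add: a_def b_def c_def window3_self)
qed

lemma L_sigma_action:
  "1 \<le> i \<Longrightarrow> i \<le> k \<Longrightarrow> L_action n k i (L k i)"
  "2 \<le> i \<Longrightarrow> i \<le> k \<Longrightarrow> swap_action n k i (i - 1) (sigma k i)"
proof (induction k i and k i rule: L_sigma.induct)
  case (2 k)
  have "w(1 := c) = relabel 1 (w 1) c w" for w :: "nat \<Rightarrow> nat" and c
    by (auto simp: relabel_def fun_eq_iff)
  then show ?case using 2 by (simp add: L_action_def act_p)
next
  case (3 k j)
  then show ?case by (simp add: L_rec_action L_sigma_in)
next
  case (6 k)
  have "w(1 := w 2, 2 := w 1) = relabel 2 (w 1) (w 2) w" for w :: "nat \<Rightarrow> nat"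
    by (auto simp: relabel_def fun_eq_iff)
  then show ?case using 6 by (simp add: swap_action_def act_s numeral_2_eq_2)
next
  case (7 k j)
  then show ?case by (simp add: sigma_rec_action L_sigma_in)
qed auto

lemma sigma_half_action:
  "1 \<le> i \<Longrightarrow> i + 1 \<le> k \<Longrightarrow> swap_action n k (i - 1) i (sigma_half k i)"
proof (induction k i rule: sigma_half.induct)
  case (2 k)
  then show ?case by (simp add: swap_action_def act_one relabel_def)
next
  case (3 k j)
  then show ?case
    using sigma_half_rec_action[of "L k (Suc j)" k "sigma_half k (Suc j)" n "Suc j"]
    by (simp add: L_sigma_in sigma_half_in L_sigma_action)
qed simp

text \<open>
  For \<open>m = i + 1\<close> the letters at positions \<open>i\<close> and \<open>i + 1\<close> are exchanged, for \<open>m = i - 1\<close> they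
  stay. Either way the new word determines the same transposition as the old one. For \<open>m = i\<close>
  this would fail.
\<close>

lemma swap_action_involution:
  assumes a: "a \<in> partition_algebra k"
    and i: "1 \<le> i" "i < k" and m: "m = i - 1 \<or> m = Suc i"
    and act: "\<And>n. swap_action n k m i a"
  shows "a \<odot> a = one k"
proof (rule act_faithful)
  fix n w and f :: "(nat \<Rightarrow> nat) \<Rightarrow> int" assume w: "w \<in> words n k"
  define v where "v = relabel m (w i) (w (Suc i)) w"
  have v: "v \<in> words n k"
    unfolding v_def using w i m by (intro relabel_words words_less) auto
  have "relabel m (v i) (v (Suc i)) v = relabel m (w i) (w (Suc i)) v"
    using m i by (auto simp: v_def relabel_def fun_eq_iff transpose_commute)
  also have "\<dots> = w"
    by (simp add: v_def relabel_def fun_eq_iff)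
  finally have "f (relabel m (v i) (v (Suc i)) v) = f w" by simp
  then show "act n k (a \<odot> a) f w = act n k (one k) f w"
    using act[of n] v w by (simp add: act_mult a act_one swap_action_def v_def)
qed (simp_all add: a one_in partition_algebra_mult)

lemma one_idem: "one k \<odot> one k = one k"
  by (rule act_faithful[where k = k]) (simp_all add: act_mult act_one one_in partition_algebra_mult)

theorem proposition4p2:
  fixes i k :: nat
  assumes "i + 1 \<le> k"
  shows "sigma_half k i \<odot> sigma_half k i = one k \<and>
         sigma k (i + 1) \<odot> sigma k (i + 1) = one k"
proof (cases i)
  case 0
  then show ?thesis by (simp add: one_idem)
next
  case (Suc j)
  have i: "1 \<le> i" "i < k" using assms Suc by auto
  have "sigma_half k i \<odot> sigma_half k i = one k"
    by (rule swap_action_involution[OF sigma_half_in[OF assms] i, of "i - 1"])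
      (use assms i sigma_half_action[of i k] in simp_all)
  moreover have "sigma k (i + 1) \<odot> sigma k (i + 1) = one k"
    by (rule swap_action_involution[OF L_sigma_in(2)[OF _ assms] i, of "Suc i"])
      (use assms i L_sigma_action(2)[of "i + 1" k] in simp_all)
  ultimately show ?thesis ..
qed

end
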